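(* The following exchange laws hold in the alternating group $Alt_n$: - for every integer $r\ge 3$ with $2r\le n$, $$v_{2r}\cdot u_{2r}=\prod_{i=2}^{r-1}\left(u_{2i}\cdot t_{2i+1}^{-1}\right)\cdot u_{2r}\cdot v_{2r};$$ - for all integers $r'>r\ge 2$ with $2r'-1\le n$, $$t_{2r'-1}\cdot t_{2r-1}=\prod_{i=2}^{r}\left(t_{2i-1}^{-1}\cdot u_{2i}\right)\cdot t_{2r'-1}.$$
   Context: $S_n$ is the symmetric group on $\{1,\ldots,n\}$ and $Alt_n\le S_n$ is the subgroup of even permutations. Permutations are multiplied left to right: $(\pi_1\cdot\pi_2)(i)=\pi_2(\pi_1(i))$. The cycle $(i_1,i_2,\ldots,i_m)$ sends $i_k\mapsto i_{k+1}$ for $1\le k\le m-1$ and $i_m\mapsto i_1$. Let $s_i=(i,i+1)$ and, for $2\le m\le n$, $t_m=s_1\cdot s_2\cdots s_{m-1}=(m,m-1,\ldots,1)$ (which lies in $Alt_n$ for $m$ odd). For every integer $r$ with $2\le r\le n/2$, $u_{2r}=t_{2r-2}\cdot s_{2r-1}=(2r-2,2r-3,\ldots,1)(2r-1,2r)$ and $v_{2r}=t_{2r}^2=(2r,2r-2,\ldots,2)(2r-1,2r-3,\ldots,1)$, which lie in $Alt_n$. Products $\prod$ range only over the parenthesized factor and are ordered, with factors multiplied from left to right in increasing order of the index $i$. *)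

theory Defs
  imports "HOL-Algebra.Sym_Groups"
begin

text \<open>
  Permutations are multiplied from left to right, whereas the multiplication of
  \<^const>\<open>alt_group\<close> is \<^term>\<open>(\<circ>)\<close>, so the alternating group used here is the opposite of
  \<^const>\<open>alt_group\<close>: same carrier, identity and inverses, reversed multiplication.
\<close>

definition lr_comp :: "('a \<Rightarrow> 'a) \<Rightarrow> ('a \<Rightarrow> 'a) \<Rightarrow> ('a \<Rightarrow> 'a)"  (infixl \<open>\<odot>\<close> 70)
  where "p \<odot> q = (\<lambda>i. q (p i))"

definition alt_group_lr :: "nat \<Rightarrow> (nat \<Rightarrow> nat) monoid"
  where "alt_group_lr n = (alt_group n) \<lparr> mult := (\<odot>) \<rparr>"

text \<open>The ordered product \<open>f a \<cdot> f (a + 1) \<cdots> f b\<close>, which is \<^term>\<open>\<one>\<^bsub>G\<^esub>\<close> if \<open>b < a\<close>.\<close>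

definition ordered_prod :: "('a, 'b) monoid_scheme \<Rightarrow> (nat \<Rightarrow> 'a) \<Rightarrow> nat \<Rightarrow> nat \<Rightarrow> 'a"
  where "ordered_prod G f a b = foldr (mult G) (map f [a..<Suc b]) \<one>\<^bsub>G\<^esub>"

text \<open>
  The permutations below fix almost all natural numbers and thus represent elements of every
  symmetric group that is large enough. The indices of \<open>alt_u\<close> and \<open>alt_v\<close> are the full (even)
  subscripts \<open>2 * r\<close>, not \<open>r\<close>.
\<close>

definition adj_transp :: "nat \<Rightarrow> nat \<Rightarrow> nat"
  where "adj_transp i = transpose i (i + 1)"

definition alt_t :: "nat \<Rightarrow> nat \<Rightarrow> nat"
  where "alt_t m = foldr (\<odot>) (map adj_transp [1..<m]) id"

definition alt_u :: "nat \<Rightarrow> nat \<Rightarrow> nat"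
  where "alt_u m = alt_t (m - 2) \<odot> adj_transp (m - 1)"

definition alt_v :: "nat \<Rightarrow> nat \<Rightarrow> nat"
  where "alt_v m = alt_t m \<odot> alt_t m"

lemma lr_comp_eq_comp: "p \<odot> q = q \<circ> p"
  by (auto simp: lr_comp_def)

lemma lr_comp_assoc: "(p \<odot> q) \<odot> r = p \<odot> (q \<odot> r)"
  by (simp add: lr_comp_def)

lemma lr_comp_id [simp]: "id \<odot> p = p" "p \<odot> id = p"
  by (simp_all add: lr_comp_def)

lemma alt_group_lr_simps:
  "carrier (alt_group_lr n) = {p. p permutes {1..n} \<and> evenperm p}"
  "mult (alt_group_lr n) = (\<odot>)"
  "one (alt_group_lr n) = id"
  by (simp_all add: alt_group_lr_def alt_group_def sym_group_def)

lemma group_alt_group_lr: "group (alt_group_lr n)"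
proof (rule groupI, goal_cases)
  case (1 p q)
  then show ?case
    using group.is_monoid[OF alt_group_is_group, THEN monoid.m_closed, of q n p]
    by (auto simp: alt_group_lr_simps alt_group_carrier alt_group_mult lr_comp_eq_comp)
next
  case (5 p)
  then have "p permutes {1..n}" "evenperm p"
    by (auto simp: alt_group_lr_simps)
  then show ?case
    by (intro bexI[of _ "inv' p"])
      (auto simp: alt_group_lr_simps lr_comp_eq_comp permutes_inv permutes_inv_o
        evenperm_inv[OF permutes_imp_permutation[OF finite_atLeastAtMost]])
qed (auto simp: alt_group_lr_simps lr_comp_assoc permutes_id evenperm_id)

lemma inv_alt_group_lr:
  assumes "p \<in> carrier (alt_group_lr n)"
  shows "inv\<^bsub>alt_group_lr n\<^esub> p = inv' p"
proof -
  have p: "p permutes {1..n}" "evenperm p"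
    using assms by (auto simp: alt_group_lr_simps)
  have "inv' p \<otimes>\<^bsub>alt_group_lr n\<^esub> p = \<one>\<^bsub>alt_group_lr n\<^esub>"
    using permutes_inv_o[OF p(1)] by (simp add: alt_group_lr_simps lr_comp_eq_comp)
  moreover have "inv' p \<in> carrier (alt_group_lr n)"
    using p by (auto simp: alt_group_lr_simps permutes_inv
        evenperm_inv[OF permutes_imp_permutation[OF finite_atLeastAtMost]])
  ultimately show ?thesis
    by (intro group.inv_equality[OF group_alt_group_lr]) (use assms in auto)
qed

lemma alt_t_Suc:
  assumes "m \<ge> 1"
  shows "alt_t (Suc m) = alt_t m \<odot> adj_transp m"
proof -
  have "foldr (\<odot>) ps q = foldr (\<odot>) ps id \<odot> q" for ps and q :: "nat \<Rightarrow> nat"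
    by (induction ps) (simp_all add: lr_comp_def)
  from this[of "map adj_transp [1..<m]" "adj_transp m"] show ?thesis
    using assms by (simp add: alt_t_def)
qed

lemma alt_t_eq_cycle: "alt_t m = cycle_of_list (rev [1..<Suc m])"
proof (induction m)
  case 0
  then show ?case by (simp add: alt_t_def)
next
  case (Suc m)
  show ?case
  proof (cases m)
    case 0
    then show ?thesis by (simp add: alt_t_def)
  next
    case (Suc k)
    then have "rev [1..<Suc (Suc m)] = Suc m # m # rev [1..<m]"
      by simp
    moreover have "rev [1..<Suc m] = m # rev [1..<m]"
      using Suc by simp
    ultimately show ?thesis
      using Suc.IH Suc alt_t_Suc[of m]
      by (simp add: lr_comp_eq_comp adj_transp_def transpose_commute)
  qed
qed

lemma alt_t_permutes: "m \<le> n \<Longrightarrow> alt_t m permutes {1..n}"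
  unfolding alt_t_eq_cycle
  by (rule permutes_subset[OF cycle_permutes]) auto

lemma adj_transp_permutes:
  assumes "1 \<le> i" "i < n"
  shows "adj_transp i permutes {1..n}"
  unfolding adj_transp_def by (rule permutes_swap_id) (use assms in auto)

lemma permutation_alt_t: "permutation (alt_t m)"
  unfolding alt_t_eq_cycle by (rule permutation_of_cycle)

lemma evenperm_alt_t: "m \<ge> 1 \<Longrightarrow> evenperm (alt_t m) \<longleftrightarrow> odd m"
proof (induction m rule: nat_induct_at_least)
  case base
  show ?case by (simp add: alt_t_def evenperm_id)
next
  case (Suc m)
  have "evenperm (adj_transp m \<circ> alt_t m) \<longleftrightarrow> even m"
    using Suc.IH evenperm_comp[OF permutation_swap_id permutation_alt_t, of m "m + 1" m]
    by (simp add: adj_transp_def evenperm_swap)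
  with Suc.hyps show ?case
    by (simp add: alt_t_Suc lr_comp_def o_def)
qed

lemma alt_t_in_alt_group_lr:
  assumes "odd m" "m \<le> n"
  shows "alt_t m \<in> carrier (alt_group_lr n)"
  using assms odd_pos[of m] alt_t_permutes[of m n] evenperm_alt_t[of m]
  by (simp add: alt_group_lr_simps)

lemma alt_u_in_alt_group_lr:
  assumes "2 \<le> r" "2 * r \<le> n"
  shows "alt_u (2 * r) \<in> carrier (alt_group_lr n)"
proof -
  have "alt_u (2 * r) permutes {1..n}"
    unfolding alt_u_def lr_comp_eq_comp
    by (intro permutes_compose alt_t_permutes adj_transp_permutes) (use assms in auto)
  moreover have "evenperm (alt_u (2 * r))"
    using assms by (simp add: alt_u_def lr_comp_eq_comp evenperm_comp permutation_alt_t
        adj_transp_def permutation_swap_id evenperm_swap evenperm_alt_t)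
  ultimately show ?thesis
    by (simp add: alt_group_lr_simps)
qed

lemma alt_v_in_alt_group_lr:
  assumes "m \<le> n"
  shows "alt_v m \<in> carrier (alt_group_lr n)"
  using permutes_compose[OF alt_t_permutes alt_t_permutes, OF assms assms]
    evenperm_comp[OF permutation_alt_t permutation_alt_t, of m m]
  by (simp add: alt_group_lr_simps alt_v_def lr_comp_eq_comp)

end

theory Submission
  imports Defs
begin

text \<open>
  Every factor of either product is a 3-cycle, and the partial products stay simple: the first
  product telescopes to the 3-cycle \<open>(1, 3, 2 r - 1)\<close>, and the second to the cycle
  \<open>(2 r, 2 r - 1, \<dots>, 2)\<close>. Both exchange laws then reduce to comparing images of points. The second
  one says that conjugation by \<open>t\<^bsub>2r'-1\<^esub>\<close> shifts the cycle \<open>t\<^bsub>2r-1\<^esub>\<close> by one.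
\<close>

text \<open>With a closed form at every natural number, equality of products becomes a finite case
  distinction. The guard \<open>i = 0\<close> keeps the truncated \<open>i - 1\<close> harmless, and
  \<open>m < i\<close> also covers the trivial \<open>m = 0\<close>.\<close>

lemma alt_t_apply:
  "alt_t m i = (if i = 0 \<or> m < i then i else if i = 1 then m else i - 1)"
proof (induction m)
  case 0
  show ?case by (simp add: alt_t_def)
next
  case (Suc m)
  show ?case
  proof (cases "m = 0")
    case True
    then show ?thesis by (simp add: alt_t_def)
  next
    case False
    then have "alt_t (Suc m) i = transpose m (m + 1) (alt_t m i)"
      by (simp add: alt_t_Suc lr_comp_def adj_transp_def)
    then show ?thesis
      using False by (auto simp: Suc.IH transpose_def)
  qed
qed

lemma alt_u_apply:
  assumes "2 \<le> r"
  shows "alt_u (2 * r) i =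
    (if i = 0 \<or> 2 * r < i then i else if i = 1 then 2 * r - 2
     else if i = 2 * r - 1 then 2 * r else if i = 2 * r then 2 * r - 1 else i - 1)"
  using assms by (auto simp: alt_u_def lr_comp_def adj_transp_def alt_t_apply transpose_def)

lemma alt_v_apply:
  assumes "2 \<le> m"
  shows "alt_v m i =
    (if i = 0 \<or> m < i then i else if i = 1 then m - 1 else if i = 2 then m else i - 2)"
  using assms by (auto simp: alt_v_def lr_comp_def alt_t_apply)

text \<open>Up to boundary effects \<open>alt_u\<close> lowers a point by 1 and \<open>alt_v\<close>
  by 2, so the two orders of composition agree except at 1, 3 and \<open>2 * r - 1\<close>. The
  commutator is therefore a 3-cycle on these points, which are distinct because
  \<open>3 \<le> r\<close>.\<close>

lemma alt_v_alt_u: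
  assumes "3 \<le> r"
  shows "alt_v (2 * r) \<odot> alt_u (2 * r) =
    cycle_of_list [1, 3, 2 * r - 1] \<odot> alt_u (2 * r) \<odot> alt_v (2 * r)"
proof
  fix j
  let ?c = "cycle_of_list [1, 3, 2 * r - 1]"
  \<comment> \<open>Both sides are traced from \<open>j\<close> to the common image
    \<open>b\<close>: through \<open>a\<close> on the left, through \<open>c\<close> and
    \<open>d\<close> on the right. Each case below names these points.\<close>
  have eq: "(alt_v (2 * r) \<odot> alt_u (2 * r)) j = (?c \<odot> alt_u (2 * r) \<odot> alt_v (2 * r)) j"
    if "alt_v (2 * r) j = a" "alt_u (2 * r) a = b"
    "?c j = c" "alt_u (2 * r) c = d" "alt_v (2 * r) d = b" for a b c d
    using that by (simp only: lr_comp_def)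
  note apply_simps = alt_u_apply alt_v_apply transpose_def
  consider "j = 0 \<or> 2 * r < j" | "j = 1" | "j = 2" | "j = 3" | "j = 2 * r - 1" | "j = 2 * r"
    | "3 < j" "j < 2 * r - 1"
    by linarith
  then show "(alt_v (2 * r) \<odot> alt_u (2 * r)) j = (?c \<odot> alt_u (2 * r) \<odot> alt_v (2 * r)) j"
  proof cases
    case 1
    show ?thesis
      by (rule eq[of j j j j]) (use assms 1 in \<open>auto simp: apply_simps\<close>)
  next
    case 2
    show ?thesis
      by (rule eq[of "2 * r - 1" "2 * r" 3 2]) (use assms 2 in \<open>auto simp: apply_simps\<close>)
  next
    case 3
    show ?thesis
      by (rule eq[of "2 * r" "2 * r - 1" 2 1]) (use assms 3 in \<open>auto simp: apply_simps\<close>)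
  next
    case 4
    show ?thesis
      by (rule eq[of 1 "2 * r - 2" "2 * r - 1" "2 * r"]) (use assms 4 in \<open>auto simp: apply_simps\<close>)
  next
    case 5
    show ?thesis
      by (rule eq[of "2 * r - 3" "2 * r - 4" 1 "2 * r - 2"]) (use assms 5 in \<open>auto simp: apply_simps\<close>)
  next
    case 6
    show ?thesis
      by (rule eq[of "2 * r - 2" "2 * r - 3" "2 * r" "2 * r - 1"]) (use assms 6 in \<open>auto simp: apply_simps\<close>)
  next
    case 7
    show ?thesis
      by (rule eq[of "j - 2" "j - 3" j "j - 1"]) (use assms 7 in \<open>auto simp: apply_simps\<close>)
  qed
qed

text \<open>The function on the right is the cycle \<open>(l + 1, l, ..., 2)\<close>. As
  \<open>l < m\<close>, \<open>alt_t m\<close> lowers each point of its support by one, onto the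
  support \<open>1, ..., l\<close> of \<open>alt_t l\<close>.\<close>

lemma alt_t_alt_t:
  assumes "1 \<le> l" "l < m"
  shows "alt_t m \<odot> alt_t l =
    (\<lambda>j. if j < 2 \<or> Suc l < j then j else if j = 2 then Suc l else j - 1) \<odot> alt_t m"
  using assms by (auto simp: fun_eq_iff lr_comp_def alt_t_apply)

lemma alt_t_inv:
  shows "alt_t m \<odot> inv' (alt_t m) = id" "inv' (alt_t m) \<odot> alt_t m = id"
  using permutes_inv_o[OF alt_t_permutes[of m m]] by (simp_all add: lr_comp_eq_comp)

text \<open>\<open>alt_u (2 * i)\<close> and \<open>alt_t (2 * i + 1)\<close> differ only at 1,
  \<open>2 * i - 1\<close> and \<open>2 * i + 1\<close>. Multiplying the inverse away first leaves
  an identity that can be checked pointwise.\<close>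

lemma alt_u_alt_t_inv:
  assumes "2 \<le> i"
  shows "alt_u (2 * i) \<odot> inv' (alt_t (2 * i + 1)) = cycle_of_list [1, 2 * i - 1, 2 * i + 1]"
proof -
  have "alt_u (2 * i) = cycle_of_list [1, 2 * i - 1, 2 * i + 1] \<odot> alt_t (2 * i + 1)"
    using assms by (auto simp: fun_eq_iff lr_comp_def alt_u_apply alt_t_apply transpose_def)
  then show ?thesis
    by (simp add: lr_comp_assoc alt_t_inv)
qed

text \<open>Here the quotient is taken on the other side, so the 3-cycle permutes the values that
  the two permutations take at the points 1, \<open>2 * i - 1\<close> and \<open>2 * i\<close> where
  they differ.\<close>

lemma alt_t_inv_alt_u:
  assumes "2 \<le> i"
  shows "inv' (alt_t (2 * i - 1)) \<odot> alt_u (2 * i) = cycle_of_list [2 * i - 2, 2 * i, 2 * i - 1]"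
proof -
  have "alt_u (2 * i) = alt_t (2 * i - 1) \<odot> cycle_of_list [2 * i - 2, 2 * i, 2 * i - 1]"
    using assms by (auto simp: fun_eq_iff lr_comp_def alt_u_apply alt_t_apply transpose_def)
  then show ?thesis
    by (simp add: lr_comp_assoc[symmetric] alt_t_inv)
qed

text \<open>\<open>foldr\<close> exposes the first factor, whereas induction on the upper bound
  needs the last one. Moving it out uses associativity, hence membership of all factors in the
  carrier.\<close>

lemma (in monoid) ordered_prod_Suc:
  assumes "a \<le> Suc b" "\<And>i. a \<le> i \<Longrightarrow> i \<le> Suc b \<Longrightarrow> f i \<in> carrier G"
  shows "ordered_prod G f a (Suc b) = ordered_prod G f a b \<otimes> f (Suc b)"
proof -
  have closed: "foldr (\<otimes>) xs \<one> \<in> carrier G" if "set xs \<subseteq> carrier G" for xs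
    using that by (induction xs) auto
  have "foldr (\<otimes>) (xs @ [x]) \<one> = foldr (\<otimes>) xs \<one> \<otimes> x"
    if "set xs \<subseteq> carrier G" "x \<in> carrier G" for xs x
    using that by (induction xs) (simp_all add: closed m_assoc)
  from this[of "map f [a..<Suc b]" "f (Suc b)"] show ?thesis
    using assms by (simp add: ordered_prod_def upt_Suc_append image_subset_iff del: upt_Suc)
qed

lemma (in monoid) ordered_prod_single: "f a \<in> carrier G \<Longrightarrow> ordered_prod G f a a = f a"
  by (simp add: ordered_prod_def)

lemma (in monoid) ordered_prod_empty: "b < a \<Longrightarrow> ordered_prod G f a b = \<one>"
  by (simp add: ordered_prod_def)

lemma ordered_prod_alt_u_alt_t_inv:
  assumes "2 \<le> r" "2 * r < n"
  shows "ordered_prod (alt_group_lr n)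
      (\<lambda>i. alt_u (2 * i) \<otimes>\<^bsub>alt_group_lr n\<^esub> inv\<^bsub>alt_group_lr n\<^esub> (alt_t (2 * i + 1))) 2 r
    = cycle_of_list [1, 3, 2 * r + 1]"
  (is "ordered_prod ?G ?f _ _ = _")
proof -
  interpret group ?G by (rule group_alt_group_lr)
  have closed: "?f i \<in> carrier ?G" if "2 \<le> i" "2 * i < n" for i
    using that by (intro m_closed inv_closed alt_u_in_alt_group_lr alt_t_in_alt_group_lr) auto
  have f: "?f i = cycle_of_list [1, 2 * i - 1, 2 * i + 1]" if "2 \<le> i" "2 * i < n" for i
    using that inv_alt_group_lr[OF alt_t_in_alt_group_lr[of "2 * i + 1" n]] alt_u_alt_t_inv
    by (simp add: alt_group_lr_simps del: cycle_of_list.simps)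
  show ?thesis
    using assms
  proof (induction r rule: nat_induct_at_least)
    case base
    have "ordered_prod ?G ?f 2 2 = ?f 2"
      using base by (intro ordered_prod_single closed) auto
    then show ?case
      using f[of 2] base by (simp del: cycle_of_list.simps)
  next
    case (Suc r)
    then have r: "2 * r < n" "2 \<le> Suc r"
      by auto
    have "ordered_prod ?G ?f 2 (Suc r) = ordered_prod ?G ?f 2 r \<otimes>\<^bsub>?G\<^esub> ?f (Suc r)"
      using Suc.hyps Suc.prems by (intro ordered_prod_Suc closed) auto
    also have "\<dots> = cycle_of_list [1, 3, 2 * r + 1] \<odot> cycle_of_list [1, 2 * Suc r - 1, 2 * Suc r + 1]"
      by (simp only: Suc.IH[OF r(1)] f[OF r(2) Suc.prems]) (simp only: alt_group_lr_simps)
    \<comment> \<open>Telescoping: the shared point \<open>2 * r + 1\<close> becomes fixed, and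
      \<open>2 * r + 3\<close> takes its place in the cycle.\<close>
    also have "\<dots> = cycle_of_list [1, 3, 2 * Suc r + 1]"
      using Suc.hyps by (auto simp: fun_eq_iff lr_comp_def transpose_def)
    finally show ?case .
  qed
qed

lemma ordered_prod_alt_t_inv_alt_u:
  assumes "1 \<le> r" "2 * r \<le> n"
  shows "ordered_prod (alt_group_lr n)
      (\<lambda>i. inv\<^bsub>alt_group_lr n\<^esub> (alt_t (2 * i - 1)) \<otimes>\<^bsub>alt_group_lr n\<^esub> alt_u (2 * i)) 2 r
    = (\<lambda>j. if j < 2 \<or> 2 * r < j then j else if j = 2 then 2 * r else j - 1)"
  (is "ordered_prod ?G ?f _ _ = ?c r")
proof -
  interpret group ?G by (rule group_alt_group_lr)
  have closed: "?f i \<in> carrier ?G" if "2 \<le> i" "2 * i \<le> n" for i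
    using that by (intro m_closed inv_closed alt_u_in_alt_group_lr alt_t_in_alt_group_lr) auto
  have f: "?f i = cycle_of_list [2 * i - 2, 2 * i, 2 * i - 1]" if "2 \<le> i" "2 * i \<le> n" for i
    using that inv_alt_group_lr[OF alt_t_in_alt_group_lr[of "2 * i - 1" n]] alt_t_inv_alt_u
    by (simp add: alt_group_lr_simps del: cycle_of_list.simps)
  show ?thesis
    using assms
  proof (induction r rule: nat_induct_at_least)
    case base
    \<comment> \<open>The product is empty, and \<open>?c 1\<close> is the identity since it sends 2
      to \<open>2 * 1\<close>.\<close>
    show ?case
      by (auto simp: ordered_prod_empty alt_group_lr_simps)
  next
    case (Suc r)
    then have r: "2 * r \<le> n" "2 \<le> Suc r"
      by auto
    have "ordered_prod ?G ?f 2 (Suc r) = ordered_prod ?G ?f 2 r \<otimes>\<^bsub>?G\<^esub> ?f (Suc r)"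
      using Suc.hyps Suc.prems by (intro ordered_prod_Suc closed) auto
    also have "\<dots> = ?c r \<odot> cycle_of_list [2 * Suc r - 2, 2 * Suc r, 2 * Suc r - 1]"
      by (simp only: Suc.IH[OF r(1)] f[OF r(2) Suc.prems]) (simp only: alt_group_lr_simps)
    \<comment> \<open>The new 3-cycle meets the old cycle only in its top point
      \<open>2 * r\<close>, so it inserts \<open>2 * r + 2\<close> and \<open>2 * r + 1\<close>
      above it.\<close>
    also have "\<dots> = ?c (Suc r)"
      using Suc.hyps by (auto simp: fun_eq_iff lr_comp_def transpose_def)
    finally show ?case .
  qed
qed

theorem proposition3p3:
  fixes n :: nat
  shows "(\<forall>r. 3 \<le> r \<and> 2 * r \<le> n \<longrightarrow>
            alt_v (2 * r) \<otimes>\<^bsub>alt_group_lr n\<^esub> alt_u (2 * r) =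
            ordered_prod (alt_group_lr n)
              (\<lambda>i. alt_u (2 * i) \<otimes>\<^bsub>alt_group_lr n\<^esub> inv\<^bsub>alt_group_lr n\<^esub> (alt_t (2 * i + 1))) 2 (r - 1)
              \<otimes>\<^bsub>alt_group_lr n\<^esub> alt_u (2 * r) \<otimes>\<^bsub>alt_group_lr n\<^esub> alt_v (2 * r)) \<and>
         (\<forall>r r'. 2 \<le> r \<and> r < r' \<and> 2 * r' - 1 \<le> n \<longrightarrow>
            alt_t (2 * r' - 1) \<otimes>\<^bsub>alt_group_lr n\<^esub> alt_t (2 * r - 1) =
            ordered_prod (alt_group_lr n)
              (\<lambda>i. inv\<^bsub>alt_group_lr n\<^esub> (alt_t (2 * i - 1)) \<otimes>\<^bsub>alt_group_lr n\<^esub> alt_u (2 * i)) 2 r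
              \<otimes>\<^bsub>alt_group_lr n\<^esub> alt_t (2 * r' - 1))"
proof (intro conjI allI impI; elim conjE)
  fix r :: nat
  assume r: "3 \<le> r" "2 * r \<le> n"
  then have "2 \<le> r - 1" "2 * (r - 1) < n" and eq: "2 * (r - 1) + 1 = 2 * r - 1"
    by auto
  from ordered_prod_alt_u_alt_t_inv[OF this(1,2)]
  show "alt_v (2 * r) \<otimes>\<^bsub>alt_group_lr n\<^esub> alt_u (2 * r) =
            ordered_prod (alt_group_lr n)
              (\<lambda>i. alt_u (2 * i) \<otimes>\<^bsub>alt_group_lr n\<^esub> inv\<^bsub>alt_group_lr n\<^esub> (alt_t (2 * i + 1))) 2 (r - 1)
              \<otimes>\<^bsub>alt_group_lr n\<^esub> alt_u (2 * r) \<otimes>\<^bsub>alt_group_lr n\<^esub> alt_v (2 * r)"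
    by (simp only: alt_v_alt_u[OF r(1)] eq alt_group_lr_simps)
next
  fix r r' :: nat
  assume r: "2 \<le> r" "r < r'" "2 * r' - 1 \<le> n"
  \<comment> \<open>For \<open>l = 2 * r - 1\<close> the shifted cycle of \<open>alt_t_alt_t\<close>
    has top point \<open>Suc l = 2 * r\<close>, exactly that of the product.\<close>
  then have "1 \<le> r" "2 * r \<le> n" and l: "1 \<le> 2 * r - 1" "2 * r - 1 < 2 * r' - 1"
    and eq: "Suc (2 * r - 1) = 2 * r"
    by auto
  from ordered_prod_alt_t_inv_alt_u[OF this(1,2)]
  show "alt_t (2 * r' - 1) \<otimes>\<^bsub>alt_group_lr n\<^esub> alt_t (2 * r - 1) =
            ordered_prod (alt_group_lr n)
              (\<lambda>i. inv\<^bsub>alt_group_lr n\<^esub> (alt_t (2 * i - 1)) \<otimes>\<^bsub>alt_group_lr n\<^esub> alt_u (2 * i)) 2 r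
              \<otimes>\<^bsub>alt_group_lr n\<^esub> alt_t (2 * r' - 1)"
    by (simp only: alt_t_alt_t[OF l] eq alt_group_lr_simps)
qed

end
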